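(* Let $(\rho,u_1,u_2,u_3,\varphi)$ be a smooth solution, with $\rho>0$ and $u_1\neq0$, on an open set of $\mathbb{R}^3$, of the steady Euler--Poisson system $$\begin{cases}\sum_{j=1}^3\partial_{j}(\rho u_j)=0,\\ \sum_{j=1}^3\partial_{j}(\rho u_iu_j)+\partial_{i}p(\rho)=\rho\,\partial_{i}\varphi,\quad i=1,2,3,\\ \Delta\varphi=\rho-b(x).\end{cases}$$ Set $\beta_2=\frac{u_2}{u_1}$, $\beta_3=\frac{u_3}{u_1}$, $G=1+\beta_2^2+\beta_3^2$, $\mathbf{D}=\partial_1+\beta_2\partial_2+\beta_3\partial_3$, $B=\frac12(u_1^2+u_2^2+u_3^2)+h(\rho)-\varphi$, and $$W=\partial_2\beta_3-\partial_3\beta_2+\beta_3\partial_1\beta_2-\beta_2\partial_1\beta_3 .$$ Then $$\mathbf{D}\left(\frac{W}{\rho G}\right)+\frac{1}{2\rho\,(B+\varphi-h(\rho))^2}\left((1,\beta_2,\beta_3)\cdot\left[\left(\frac{c^2(\rho)}{\rho}\nabla\rho-\nabla\varphi\right)\times\nabla B\right]\right)=0 .$$ In particular, if $B$ is constant, then $\mathbf{D}\left(\frac{W}{\rho G}\right)=0$, i.e. $\frac{W}{\rho G}$ is conserved along particle paths.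
   Context: $p=p(\rho)$ is a given smooth pressure law with $p'(\rho)>0$, $c^2(\rho)=p'(\rho)$, and $h$ is an enthalpy function with $h'(\rho)=c^2(\rho)/\rho$. $b(x)$ is a given function (ion background density). $\partial_i=\partial/\partial x_i$; $\times$ and $\cdot$ denote the cross and dot products in $\mathbb{R}^3$. Particle paths are the integral curves of the vector field $(1,\beta_2,\beta_3)$. *)

theory Defs
  imports "HOL-Analysis.Analysis"
begin

definition dir_deriv :: "'a::real_normed_vector \<Rightarrow> ('a \<Rightarrow> real) \<Rightarrow> 'a \<Rightarrow> real" where
  "dir_deriv e f x = deriv (\<lambda>t. f (x + t *\<^sub>R e)) 0"

abbreviation pderiv_at :: "3 \<Rightarrow> (real^3 \<Rightarrow> real) \<Rightarrow> real^3 \<Rightarrow> real" where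
  "pderiv_at i \<equiv> dir_deriv (axis i 1)"

(* Intended for open S. On the real line the only basis vector is 1, so the same
   definition covers functions of one real variable. *)
primrec Ck_on :: "nat \<Rightarrow> 'a::euclidean_space set \<Rightarrow> ('a \<Rightarrow> real) \<Rightarrow> bool" where
  "Ck_on 0 S f \<longleftrightarrow> continuous_on S f"
| "Ck_on (Suc k) S f \<longleftrightarrow>
     (\<forall>x\<in>S. f differentiable (at x)) \<and> (\<forall>e\<in>Basis. Ck_on k S (dir_deriv e f))"

definition smooth_on :: "'a::euclidean_space set \<Rightarrow> ('a \<Rightarrow> real) \<Rightarrow> bool" where
  "smooth_on S f \<longleftrightarrow> (\<forall>k. Ck_on k S f)"

definition grad :: "(real^3 \<Rightarrow> real) \<Rightarrow> real^3 \<Rightarrow> real^3" where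
  "grad f x = (\<chi> i. pderiv_at i f x)"

definition laplacian :: "(real^3 \<Rightarrow> real) \<Rightarrow> real^3 \<Rightarrow> real" where
  "laplacian f x = (\<Sum>i\<in>UNIV. pderiv_at i (pderiv_at i f) x)"

definition sound_speed_sq :: "(real \<Rightarrow> real) \<Rightarrow> real \<Rightarrow> real" where
  "sound_speed_sq p r = deriv p r"

definition steady_euler_poisson ::
  "(real \<Rightarrow> real) \<Rightarrow> (real^3 \<Rightarrow> real) \<Rightarrow> (real^3) set \<Rightarrow>
   (real^3 \<Rightarrow> real) \<Rightarrow> (real^3 \<Rightarrow> real^3) \<Rightarrow> (real^3 \<Rightarrow> real) \<Rightarrow> bool" where
  "steady_euler_poisson p b U \<rho> u \<phi> \<longleftrightarrow>
    (\<forall>x\<in>U.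
      (\<Sum>j\<in>UNIV. pderiv_at j (\<lambda>y. \<rho> y * u y $ j) x) = 0 \<and>
      (\<forall>i. (\<Sum>j\<in>UNIV. pderiv_at j (\<lambda>y. \<rho> y * u y $ i * u y $ j) x)
            + pderiv_at i (\<lambda>y. p (\<rho> y)) x = \<rho> x * pderiv_at i \<phi> x) \<and>
      laplacian \<phi> x = \<rho> x - b x)"

definition beta :: "(real^3 \<Rightarrow> real^3) \<Rightarrow> 3 \<Rightarrow> real^3 \<Rightarrow> real" where
  "beta u i x = u x $ i / u x $ 1"

definition path_field :: "(real^3 \<Rightarrow> real^3) \<Rightarrow> real^3 \<Rightarrow> real^3" where
  "path_field u x = vector [1, beta u 2 x, beta u 3 x]"

definition G_fun :: "(real^3 \<Rightarrow> real^3) \<Rightarrow> real^3 \<Rightarrow> real" where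
  "G_fun u x = 1 + (beta u 2 x)\<^sup>2 + (beta u 3 x)\<^sup>2"

definition D_op :: "(real^3 \<Rightarrow> real^3) \<Rightarrow> (real^3 \<Rightarrow> real) \<Rightarrow> real^3 \<Rightarrow> real" where
  "D_op u f x = pderiv_at 1 f x + beta u 2 x * pderiv_at 2 f x + beta u 3 x * pderiv_at 3 f x"

definition bernoulli_fun ::
  "(real \<Rightarrow> real) \<Rightarrow> (real^3 \<Rightarrow> real) \<Rightarrow> (real^3 \<Rightarrow> real^3) \<Rightarrow> (real^3 \<Rightarrow> real) \<Rightarrow> real^3 \<Rightarrow> real" where
  "bernoulli_fun h \<rho> u \<phi> x =
     ((u x $ 1)\<^sup>2 + (u x $ 2)\<^sup>2 + (u x $ 3)\<^sup>2) / 2 + h (\<rho> x) - \<phi> x"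

definition W_fun :: "(real^3 \<Rightarrow> real^3) \<Rightarrow> real^3 \<Rightarrow> real" where
  "W_fun u x = pderiv_at 2 (beta u 3) x - pderiv_at 3 (beta u 2) x
     + beta u 3 x * pderiv_at 1 (beta u 2) x - beta u 2 x * pderiv_at 1 (beta u 3) x"

(* At an endpoint belonging to I the derivative is one-sided. *)
definition particle_path ::
  "(real^3 \<Rightarrow> real^3) \<Rightarrow> (real^3) set \<Rightarrow> real set \<Rightarrow> (real \<Rightarrow> real^3) \<Rightarrow> bool" where
  "particle_path u U I \<gamma> \<longleftrightarrow> is_interval I \<and>
     (\<forall>t\<in>I. \<gamma> t \<in> U \<and> (\<gamma> has_vector_derivative path_field u (\<gamma> t)) (at t within I))"

end

(* Write u = u_1 (1, beta_2, beta_3), omega = curl u, S = |u|^2 and N = u . omega.  Then W = N / u_1^2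
   and G = S / u_1^2, so the transported quantity W / (rho G) equals N / (rho S).  The momentum
   equation takes Lamb's form grad B = u x omega, hence S omega = N u + grad B x u.  Taking the
   divergence and using div omega = 0, curl (grad B) = 0 and grad B . omega = 0 gives
   u . grad N + N div u = grad S . omega.  Together with mass conservation and
   grad S = 2 (grad B - c^2/rho grad rho + grad phi) this is the claimed identity, up to the
   factor u_1 between D and u . grad. *)
theory Submission
  imports Defs
begin

section \<open>Directional derivatives and the symmetry of second derivatives\<close>

lemma dir_deriv_eq_frechet:
  assumes "(f has_derivative f') (at x)"
  shows "dir_deriv e f x = f' e"
proof -
  have "((\<lambda>t. f (x + t *\<^sub>R e)) has_derivative (\<lambda>t. f' (t *\<^sub>R e))) (at 0)"
    by (rule has_derivative_compose[where s=UNIV and g=f, simplified])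
       (auto intro!: derivative_eq_intros assms)
  moreover have "(\<lambda>t. f' (t *\<^sub>R e)) = (*) (f' e)"
    using has_derivative_linear[OF assms] by (auto simp: linear_cmul)
  ultimately show ?thesis
    by (simp add: dir_deriv_def DERIV_imp_deriv has_field_derivative_def)
qed

lemma has_real_derivative_along_line:
  assumes "f differentiable (at (x + s *\<^sub>R e))"
  shows "((\<lambda>t. f (x + t *\<^sub>R e)) has_real_derivative dir_deriv e f (x + s *\<^sub>R e)) (at s)"
proof -
  obtain f' where f': "(f has_derivative f') (at (x + s *\<^sub>R e))"
    using assms by (auto simp: differentiable_def)
  have "((\<lambda>t. f (x + t *\<^sub>R e)) has_derivative (\<lambda>t. f' (t *\<^sub>R e))) (at s)"
    by (rule has_derivative_compose[where s=UNIV and g=f, simplified])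
       (auto intro!: derivative_eq_intros f')
  moreover have "(\<lambda>t. f' (t *\<^sub>R e)) = (*) (f' e)"
    using has_derivative_linear[OF f'] by (auto simp: linear_cmul)
  ultimately show ?thesis
    by (simp add: dir_deriv_eq_frechet[OF f'] has_field_derivative_def)
qed

text \<open>Only values near \<open>x\<close> enter the difference quotient. This is what allows an
  identity known merely on the open set \<open>U\<close> to be differentiated there.\<close>

lemma dir_deriv_cong:
  assumes "open U" "x \<in> U" "\<And>y. y \<in> U \<Longrightarrow> f y = g y"
  shows "dir_deriv e f x = dir_deriv e g x"
proof -
  have "((\<lambda>t. x + t *\<^sub>R e) \<longlongrightarrow> x + 0 *\<^sub>R e) (nhds 0)"
    by (intro tendsto_intros filterlim_ident)
  then have "\<forall>\<^sub>F t in nhds 0. x + t *\<^sub>R e \<in> U"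
    using assms by (intro topological_tendstoD[where S=U]) auto
  then have "\<forall>\<^sub>F t in nhds 0. f (x + t *\<^sub>R e) = g (x + t *\<^sub>R e)"
    by eventually_elim (rule assms)
  then show ?thesis
    unfolding dir_deriv_def by (rule deriv_cong_ev) simp
qed

text \<open>The limit of the second difference quotient picks out one of the two mixed derivatives, while the
  quotient itself is symmetric in \<open>a\<close> and \<open>b\<close>; so differentiability of the first derivatives at the
  single point \<open>x\<close> already gives Young's theorem.\<close>

lemma second_difference_tendsto:
  fixes f :: "'a::real_normed_vector \<Rightarrow> real"
  assumes "open U" "x \<in> U" and f: "\<And>y. y \<in> U \<Longrightarrow> f differentiable (at y)"
    and fa: "dir_deriv a f differentiable (at x)"
  shows "((\<lambda>t. (f (x + t *\<^sub>R a + t *\<^sub>R b) - f (x + t *\<^sub>R a) - f (x + t *\<^sub>R b) + f x) / t\<^sup>2)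
          \<longlongrightarrow> dir_deriv b (dir_deriv a f) x) (at_right 0)"
proof -
  define g where "g = dir_deriv a f"
  obtain g' where g': "(g has_derivative g') (at x)"
    using fa by (auto simp: differentiable_def g_def)
  interpret g': bounded_linear g' using g' by (rule has_derivative_bounded_linear)
  \<comment> \<open>Bounds the displacements \<open>s *\<^sub>R a + q *\<^sub>R b\<close> with |s|,
    |q| \<le> t by \<open>t * C\<close>; the summand 1 keeps \<open>C\<close> positive even when
    \<open>a\<close> and \<open>b\<close> vanish.\<close>
  define C where "C = 2 * norm a + norm b + 1"
  have C: "C > 0" using norm_ge_zero[of a] norm_ge_zero[of b] by (simp add: C_def add_nonneg_pos)
  obtain r where r: "r > 0" "ball x r \<subseteq> U"
    using assms by (meson openE)
  show ?thesis
  proof (rule tendstoI)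
    fix \<epsilon> :: real assume "\<epsilon> > 0"
    \<comment> \<open>Two remainders, each at most \<open>\<eta> * (t * C)\<close>, will be divided
      by \<open>t\<close>; with this choice they contribute at most \<epsilon>/2 together.\<close>
    define \<eta> where "\<eta> = \<epsilon> / (4 * C)"
    have \<eta>: "\<eta> > 0" using \<open>\<epsilon> > 0\<close> C by (simp add: \<eta>_def)
    obtain d where d: "d > 0"
      "\<And>y. norm (y - x) < d \<Longrightarrow> norm (g y - g x - g' (y - x)) \<le> \<eta> * norm (y - x)"
      using g' \<eta> unfolding has_derivative_at_alt by blast
    \<comment> \<open>For \<open>t\<close> below this, all displaced points lie in the ball inside
      \<open>U\<close> and in the range where the linear approximation of \<open>g\<close>
      holds.\<close>
    define \<delta> where "\<delta> = min r d / C"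
    have \<delta>: "\<delta> > 0" using r d C by (simp add: \<delta>_def)
    have "dist ((f (x + t *\<^sub>R a + t *\<^sub>R b) - f (x + t *\<^sub>R a) - f (x + t *\<^sub>R b) + f x) / t\<^sup>2) (g' b) < \<epsilon>"
      if t: "0 < t" "t < \<delta>" for t
    proof -
      have bd: "norm (s *\<^sub>R a + q *\<^sub>R b) \<le> t * C" if "\<bar>s\<bar> \<le> t" "\<bar>q\<bar> \<le> t" for s q
      proof -
        have "norm (s *\<^sub>R a + q *\<^sub>R b) \<le> \<bar>s\<bar> * norm a + \<bar>q\<bar> * norm b"
          by (metis norm_triangle_ineq norm_scaleR)
        also have "\<dots> \<le> t * norm a + t * norm b"
          using that by (intro add_mono mult_right_mono) auto
        also have "\<dots> \<le> t * C" 
          using t by (simp add: C_def flip: distrib_left)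
        finally show ?thesis .
      qed
      have tC: "t * C < r" "t * C < d"
        using t C by (auto simp: \<delta>_def field_simps)
      have inU: "x + s *\<^sub>R a + q *\<^sub>R b \<in> U" if "\<bar>s\<bar> \<le> t" "\<bar>q\<bar> \<le> t" for s q
      proof -
        have "dist (x + s *\<^sub>R a + q *\<^sub>R b) x < r"
          using bd[OF that] tC by (simp add: dist_norm add.assoc)
        then show ?thesis using r by (auto simp: dist_commute)
      qed
      \<comment> \<open>The second difference is \<open>\<psi> t - \<psi> 0\<close>. The mean value
        theorem for \<psi> turns it into a first difference of \<open>g\<close>, to which the
        expansion at \<open>x\<close> applies.\<close>
      define \<psi> where "\<psi> s = f (x + t *\<^sub>R b + s *\<^sub>R a) - f (x + s *\<^sub>R a)" for s
      have d\<psi>: "(\<psi> has_real_derivative (g (x + t *\<^sub>R b + s *\<^sub>R a) - g (x + s *\<^sub>R a))) (at s)"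
        if "0 \<le> s" "s \<le> t" for s
        unfolding \<psi>_def g_def using that t inU[of s t] inU[of s 0]
        by (intro DERIV_diff has_real_derivative_along_line f) (auto simp: algebra_simps)
      obtain s where s: "0 < s" "s < t" 
        "\<psi> t - \<psi> 0 = t * (g (x + t *\<^sub>R b + s *\<^sub>R a) - g (x + s *\<^sub>R a))"
        using MVT2[of 0 t \<psi>, OF t(1) d\<psi>] by auto
      let ?e1 = "g (x + t *\<^sub>R b + s *\<^sub>R a) - g x - g' (t *\<^sub>R b + s *\<^sub>R a)"
      let ?e2 = "g (x + s *\<^sub>R a) - g x - g' (s *\<^sub>R a)"
      have n1: "norm (t *\<^sub>R b + s *\<^sub>R a) \<le> t * C" and n2: "norm (s *\<^sub>R a) \<le> t * C"
        using bd[of s t] bd[of s 0] s by (auto simp: add.commute)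
      have "\<bar>?e1\<bar> \<le> \<eta> * norm (t *\<^sub>R b + s *\<^sub>R a)"
        using d(2)[of "x + t *\<^sub>R b + s *\<^sub>R a"] n1 tC by (simp add: add.assoc)
      also have "\<dots> \<le> \<eta> * (t * C)" using n1 \<eta> by (intro mult_left_mono) auto
      finally have e1: "\<bar>?e1\<bar> \<le> \<eta> * (t * C)" .
      have "\<bar>?e2\<bar> \<le> \<eta> * norm (s *\<^sub>R a)"
        using d(2)[of "x + s *\<^sub>R a"] n2 tC by simp
      also have "\<dots> \<le> \<eta> * (t * C)" using n2 \<eta> by (intro mult_left_mono) auto
      finally have e2: "\<bar>?e2\<bar> \<le> \<eta> * (t * C)" .
      have "(f (x + t *\<^sub>R a + t *\<^sub>R b) - f (x + t *\<^sub>R a) - f (x + t *\<^sub>R b) + f x) / t\<^sup>2 - g' b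
            = (?e1 - ?e2) / t"
      proof -
        have "f (x + t *\<^sub>R a + t *\<^sub>R b) - f (x + t *\<^sub>R a) - f (x + t *\<^sub>R b) + f x = \<psi> t - \<psi> 0"
          by (simp add: \<psi>_def add_ac)
        also have "\<dots> = t * (?e1 - ?e2 + t * g' b)"
          by (simp add: s g'.add g'.scaleR)
        finally have num: "f (x + t *\<^sub>R a + t *\<^sub>R b) - f (x + t *\<^sub>R a) - f (x + t *\<^sub>R b) + f x
            = t * (?e1 - ?e2 + t * g' b)" .
        \<comment> \<open>The linear parts of the two expansions differ by exactly
          \<open>t * g' b\<close>, so after division by \<open>t\<^sup>2\<close> only the remainders
          survive.\<close>
        have "t * (E + t * c) / t\<^sup>2 - c = E / t" for E c
          using t by (simp add: field_simps power2_eq_square)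
        then show ?thesis unfolding num .
      qed
      also have "\<bar>\<dots>\<bar> \<le> (2 * (\<eta> * (t * C))) / t"
        unfolding abs_divide using e1 e2 t by (intro frac_le) linarith+
      also have "\<dots> < \<epsilon>" using t C \<open>\<epsilon> > 0\<close> by (simp add: \<eta>_def field_simps)
      finally show ?thesis by (simp add: dist_real_def)
    qed
    then show "\<forall>\<^sub>F t in at_right 0. dist ((f (x + t *\<^sub>R a + t *\<^sub>R b) - f (x + t *\<^sub>R a)
        - f (x + t *\<^sub>R b) + f x) / t\<^sup>2) (dir_deriv b (dir_deriv a f) x) < \<epsilon>"
      unfolding g_def[symmetric] dir_deriv_eq_frechet[OF g'] eventually_at_right_field
      using \<delta> by blast
  qed
qed

lemma dir_deriv_commute:
  fixes f :: "'a::real_normed_vector \<Rightarrow> real"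
  assumes "open U" "x \<in> U" "\<And>y. y \<in> U \<Longrightarrow> f differentiable (at y)"
    and "dir_deriv a f differentiable (at x)" "dir_deriv b f differentiable (at x)"
  shows "dir_deriv b (dir_deriv a f) x = dir_deriv a (dir_deriv b f) x"
proof (rule tendsto_unique)
  show "((\<lambda>t. (f (x + t *\<^sub>R a + t *\<^sub>R b) - f (x + t *\<^sub>R a) - f (x + t *\<^sub>R b) + f x) / t\<^sup>2)
          \<longlongrightarrow> dir_deriv b (dir_deriv a f) x) (at_right 0)"
    by (rule second_difference_tendsto) (use assms in auto)
  show "((\<lambda>t. (f (x + t *\<^sub>R a + t *\<^sub>R b) - f (x + t *\<^sub>R a) - f (x + t *\<^sub>R b) + f x) / t\<^sup>2)
          \<longlongrightarrow> dir_deriv a (dir_deriv b f) x) (at_right 0)"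
    using second_difference_tendsto[OF assms(1-3,5), where b=a]
    by (simp add: algebra_simps)
qed simp

section \<open>Calculus rules for directional derivatives and smooth functions\<close>

lemma differentiable_cong_open:
  assumes "open U" "x \<in> U" "\<And>y. y \<in> U \<Longrightarrow> f y = g y" "g differentiable (at x)"
  shows "f differentiable (at x)"
  using assms by (metis differentiable_def has_derivative_transform_within_open)

lemma dir_deriv_eqI:
  assumes "((\<lambda>t. f (x + t *\<^sub>R e)) has_real_derivative d) (at 0)"
  shows "dir_deriv e f x = d"
  using assms by (simp add: dir_deriv_def DERIV_imp_deriv)

lemma has_real_derivative_dir_deriv:
  assumes "f differentiable (at x)"
  shows "((\<lambda>t. f (x + t *\<^sub>R e)) has_real_derivative dir_deriv e f x) (at 0)"
  using has_real_derivative_along_line[where s=0] assms by simp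

lemma dir_deriv_add:
  assumes "f differentiable (at x)" "g differentiable (at x)"
  shows "dir_deriv e (\<lambda>y. f y + g y) x = dir_deriv e f x + dir_deriv e g x"
  by (rule dir_deriv_eqI)
     (auto intro!: derivative_eq_intros assms[THEN has_real_derivative_dir_deriv])

lemma dir_deriv_diff:
  assumes "f differentiable (at x)" "g differentiable (at x)"
  shows "dir_deriv e (\<lambda>y. f y - g y) x = dir_deriv e f x - dir_deriv e g x"
  by (rule dir_deriv_eqI)
     (auto intro!: derivative_eq_intros assms[THEN has_real_derivative_dir_deriv])

lemma dir_deriv_mult:
  assumes "f differentiable (at x)" "g differentiable (at x)"
  shows "dir_deriv e (\<lambda>y. f y * g y) x = dir_deriv e f x * g x + f x * dir_deriv e g x"
  by (rule dir_deriv_eqI)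
     (auto intro!: derivative_eq_intros assms[THEN has_real_derivative_dir_deriv])

lemma dir_deriv_divide:
  assumes "f differentiable (at x)" "g differentiable (at x)" "g x \<noteq> 0"
  shows "dir_deriv e (\<lambda>y. f y / g y) x = (dir_deriv e f x * g x - f x * dir_deriv e g x) / (g x)\<^sup>2"
  by (rule dir_deriv_eqI)
     (auto intro!: derivative_eq_intros assms(1,2)[THEN has_real_derivative_dir_deriv]
        simp: assms(3) power2_eq_square)

lemma dir_deriv_chain:
  assumes "f differentiable (at x)" "(g has_real_derivative d) (at (f x))"
  shows "dir_deriv e (\<lambda>y. g (f y)) x = d * dir_deriv e f x"
  by (rule dir_deriv_eqI, rule DERIV_chain2[where f=g])
     (use assms in \<open>auto intro: has_real_derivative_dir_deriv\<close>)

lemma differentiable_real_chain: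
  assumes "f differentiable (at x)" "g differentiable (at (f x :: real))"
  shows "(\<lambda>y. g (f y)) differentiable (at x)"
  using differentiable_chain_at[OF assms] by (simp add: o_def)

lemma smooth_on_imp_differentiable:
  assumes "smooth_on S f" "x \<in> S"
  shows "f differentiable (at x)"
proof -
  have "Ck_on (Suc 0) S f" using assms by (simp add: smooth_on_def del: Ck_on.simps)
  then show ?thesis using assms by simp
qed

lemma smooth_on_dir_deriv:
  assumes "smooth_on S f" "e \<in> Basis"
  shows "smooth_on S (dir_deriv e f)"
  unfolding smooth_on_def
proof
  fix k
  have "Ck_on (Suc k) S f" using assms by (simp add: smooth_on_def del: Ck_on.simps)
  then show "Ck_on k S (dir_deriv e f)" using assms by simp
qed

text \<open>On the real line the direction 1 gives the ordinary derivative. It serves to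
  differentiate the squared sound speed, which is \<open>deriv p\<close>.\<close>

lemma differentiable_deriv_of_smooth_on:
  assumes "smooth_on S p" "r \<in> S"
  shows "deriv p differentiable (at r)"
proof -
  have "dir_deriv 1 p = deriv p"
    by (simp add: dir_deriv_def fun_eq_iff deriv_shift_0[of p] o_def)
  then show ?thesis
    using smooth_on_imp_differentiable[OF smooth_on_dir_deriv[OF assms(1), of 1] assms(2)] by simp
qed

lemma axis_1_in_Basis: "axis i 1 \<in> (Basis :: (real^3) set)"
  by (simp add: axis_in_Basis_iff)

section \<open>Vector calculus in three dimensions\<close>

definition divergence :: "(real^3 \<Rightarrow> real^3) \<Rightarrow> real^3 \<Rightarrow> real" where
  "divergence v x = (\<Sum>i\<in>UNIV. pderiv_at i (\<lambda>y. v y $ i) x)"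

definition curl :: "(real^3 \<Rightarrow> real^3) \<Rightarrow> real^3 \<Rightarrow> real^3" where
  "curl v x = vector
     [pderiv_at 2 (\<lambda>y. v y $ 3) x - pderiv_at 3 (\<lambda>y. v y $ 2) x,
      pderiv_at 3 (\<lambda>y. v y $ 1) x - pderiv_at 1 (\<lambda>y. v y $ 3) x,
      pderiv_at 1 (\<lambda>y. v y $ 2) x - pderiv_at 2 (\<lambda>y. v y $ 1) x]"

lemma grad_nth [simp]: "grad f x $ i = pderiv_at i f x"
  by (simp add: grad_def)

lemma inner_3: "v \<bullet> w = v $ 1 * w $ 1 + v $ 2 * w $ 2 + v $ 3 * w $ 3" for v w :: "real^3"
  by (simp add: inner_vec_def sum_3)

lemma cross3_nth [simp]:
  "cross3 v w $ 1 = v $ 2 * w $ 3 - v $ 3 * w $ 2"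
  "cross3 v w $ 2 = v $ 3 * w $ 1 - v $ 1 * w $ 3"
  "cross3 v w $ 3 = v $ 1 * w $ 2 - v $ 2 * w $ 1"
  by (simp_all add: cross3_def)

lemma curl_nth [simp]:
  "curl v x $ 1 = pderiv_at 2 (\<lambda>y. v y $ 3) x - pderiv_at 3 (\<lambda>y. v y $ 2) x"
  "curl v x $ 2 = pderiv_at 3 (\<lambda>y. v y $ 1) x - pderiv_at 1 (\<lambda>y. v y $ 3) x"
  "curl v x $ 3 = pderiv_at 1 (\<lambda>y. v y $ 2) x - pderiv_at 2 (\<lambda>y. v y $ 1) x"
  by (simp_all add: curl_def)

lemma grad_cong:
  assumes "open U" "x \<in> U" "\<And>y. y \<in> U \<Longrightarrow> f y = g y"
  shows "grad f x = grad g x"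
  using dir_deriv_cong[OF assms] by (simp add: grad_def)

lemma divergence_cong:
  assumes "open U" "x \<in> U" "\<And>y. y \<in> U \<Longrightarrow> v y = w y"
  shows "divergence v x = divergence w x"
  unfolding divergence_def 
  by (intro sum.cong refl dir_deriv_cong[OF assms(1,2)]) (simp add: assms)

lemma differentiable_inner_3:
  fixes v w :: "real^3 \<Rightarrow> real^3"
  assumes "\<And>i. (\<lambda>y. v y $ i) differentiable (at x)" "\<And>i. (\<lambda>y. w y $ i) differentiable (at x)"
  shows "(\<lambda>y. v y \<bullet> w y) differentiable (at x)"
  unfolding inner_3 by (intro differentiable_add differentiable_mult assms)

lemma divergence_scaleR:
  assumes "f differentiable (at x)" "\<And>i. (\<lambda>y. v y $ i) differentiable (at x)"
  shows "divergence (\<lambda>y. f y *\<^sub>R v y) x = grad f x \<bullet> v x + f x * divergence v x"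
  using assms by (simp add: divergence_def sum_3 inner_3 dir_deriv_mult algebra_simps)

lemma divergence_add:
  assumes "\<And>i. (\<lambda>y. v y $ i) differentiable (at x)" "\<And>i. (\<lambda>y. w y $ i) differentiable (at x)"
  shows "divergence (\<lambda>y. v y + w y) x = divergence v x + divergence w x"
  using assms by (simp add: divergence_def sum_3 dir_deriv_add algebra_simps)

lemma divergence_cross3:
  assumes "\<And>i. (\<lambda>y. v y $ i) differentiable (at x)" "\<And>i. (\<lambda>y. w y $ i) differentiable (at x)"
  shows "divergence (\<lambda>y. cross3 (v y) (w y)) x = curl v x \<bullet> w x - v x \<bullet> curl w x"
  using assms
  by (simp add: divergence_def sum_3 inner_3 dir_deriv_diff dir_deriv_mult
      algebra_simps)

text \<open>Each component is a difference of two mixed second derivatives of \<open>f\<close>,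
  which agree.\<close>

lemma curl_grad:
  assumes "open U" "x \<in> U" "\<And>y. y \<in> U \<Longrightarrow> f differentiable (at y)"
    and "\<And>i. pderiv_at i f differentiable (at x)"
  shows "curl (grad f) x = 0"
  using dir_deriv_commute[OF assms(1-3) assms(4) assms(4)]
  by (simp add: vec_eq_iff forall_3)

text \<open>The six second derivatives cancel in pairs, again by symmetry.\<close>

lemma divergence_curl:
  assumes "open U" "x \<in> U" "\<And>i y. y \<in> U \<Longrightarrow> (\<lambda>y. v y $ i) differentiable (at y)"
    and d: "\<And>i j. pderiv_at j (\<lambda>y. v y $ i) differentiable (at x)"
  shows "divergence (curl v) x = 0"
  using dir_deriv_commute[OF assms(1-3) d d]
  by (simp add: divergence_def sum_3 dir_deriv_diff d)

lemma grad_mult: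
  assumes "f differentiable (at x)" "g differentiable (at x)"
  shows "grad (\<lambda>y. f y * g y) x = g x *\<^sub>R grad f x + f x *\<^sub>R grad g x"
  using assms by (simp add: vec_eq_iff dir_deriv_mult)

lemma grad_divide:
  assumes "f differentiable (at x)" "g differentiable (at x)" "g x \<noteq> 0"
  shows "grad (\<lambda>y. f y / g y) x = (g x *\<^sub>R grad f x - f x *\<^sub>R grad g x) /\<^sub>R (g x)\<^sup>2"
  using assms by (simp add: vec_eq_iff dir_deriv_divide divide_simps mult.commute)

text \<open>Links the total derivative, which obeys the chain rule along curves, with the partial
  derivatives used in \<open>D_op\<close>.\<close>

lemma frechet_eq_inner_grad:
  fixes f :: "real^3 \<Rightarrow> real"
  assumes "(f has_derivative f') (at x)"
  shows "f' v = v \<bullet> grad f x"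
proof -
  interpret bounded_linear f' using assms by (rule has_derivative_bounded_linear)
  have "f' v = f' (\<Sum>i\<in>UNIV. v $ i *\<^sub>R axis i 1)"
    by (simp add: basis_expansion flip: scalar_mult_eq_scaleR)
  also have "\<dots> = v \<bullet> grad f x"
    by (simp add: sum scaleR inner_vec_def dir_deriv_eq_frechet[OF assms])
  finally show ?thesis .
qed

section \<open>The slope quantities in terms of the velocity\<close>

text \<open>\<open>W_fun u\<close> is v . curl v for the path field v = (1, beta_2, beta_3).
  Rescaling a field by a function f multiplies this density by f^2, because grad f x v is orthogonal
  to v; here f = 1/u_1. The proof checks this in components.\<close>

lemma W_fun_eq:
  assumes "\<And>i. (\<lambda>y. u y $ i) differentiable (at x)" "u x $ 1 \<noteq> 0"
  shows "W_fun u x = (u x \<bullet> curl u x) / (u x $ 1)\<^sup>2"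
proof -
  have b: "pderiv_at j (beta u i) x
      = (pderiv_at j (\<lambda>y. u y $ i) x * u x $ 1 - u x $ i * pderiv_at j (\<lambda>y. u y $ 1) x) / (u x $ 1)\<^sup>2"
    for i j
    unfolding beta_def[abs_def] by (rule dir_deriv_divide) (use assms in auto)
  show ?thesis
    unfolding W_fun_def b beta_def inner_3 curl_nth using assms(2)
    by (simp add: divide_simps) (simp add: algebra_simps power2_eq_square)
qed

lemma G_fun_eq:
  assumes "u x $ 1 \<noteq> 0"
  shows "G_fun u x = (u x \<bullet> u x) / (u x $ 1)\<^sup>2"
  using assms by (simp add: G_fun_def beta_def inner_3 power_divide divide_simps power2_eq_square)

lemma path_field_eq:
  assumes "u x $ 1 \<noteq> 0"
  shows "path_field u x = u x /\<^sub>R u x $ 1"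
  using assms by (simp add: path_field_def beta_def vec_eq_iff forall_3 divide_simps)

lemma D_op_eq: "D_op u f x = path_field u x \<bullet> grad f x"
  by (simp add: D_op_def path_field_def inner_3)

section \<open>The balance laws of the flow and Lamb's form\<close>

context
  fixes U :: "(real^3) set"
    and p h :: "real \<Rightarrow> real"
    and b \<rho> \<phi> :: "real^3 \<Rightarrow> real"
    and u :: "real^3 \<Rightarrow> real^3"
  assumes p_smooth: "smooth_on {0<..} p"
    and enthalpy: "\<And>r. r > 0 \<Longrightarrow> (h has_real_derivative sound_speed_sq p r / r) (at r)"
    and U_open: "open U"
    and rho_smooth: "smooth_on U \<rho>"
    and u_smooth: "\<And>i. smooth_on U (\<lambda>x. u x $ i)"
    and phi_smooth: "smooth_on U \<phi>"
    and rho_pos: "\<And>x. x \<in> U \<Longrightarrow> \<rho> x > 0"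
    and u1_nonzero: "\<And>x. x \<in> U \<Longrightarrow> u x $ 1 \<noteq> 0"
    and solution: "steady_euler_poisson p b U \<rho> u \<phi>"
begin

abbreviation (input) "bernoulli \<equiv> bernoulli_fun h \<rho> u \<phi>"
text \<open>The gradient of h(rho) - phi, written through the sound speed. By the momentum equation
  it is minus the acceleration (u . grad) u.\<close>

abbreviation (input) "neg_force y \<equiv> (sound_speed_sq p (\<rho> y) / \<rho> y) *\<^sub>R grad \<rho> y - grad \<phi> y"

lemma differentiable_data:
  assumes "x \<in> U"
  shows "\<rho> differentiable (at x)" "\<phi> differentiable (at x)" "(\<lambda>y. u y $ i) differentiable (at x)"
    "pderiv_at j \<rho> differentiable (at x)" "pderiv_at j \<phi> differentiable (at x)"
    "pderiv_at j (\<lambda>y. u y $ i) differentiable (at x)"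
  using assms
  by (auto intro!: smooth_on_imp_differentiable[of U] smooth_on_dir_deriv axis_1_in_Basis
      rho_smooth u_smooth phi_smooth)

lemma differentiable_curl_u:
  assumes "x \<in> U"
  shows "(\<lambda>y. curl u y $ i) differentiable (at x)"
  using exhaust_3[of i] differentiable_data(6)[OF assms]
  by (auto intro!: differentiable_diff)

lemma grad_bernoulli_fun:
  assumes "x \<in> U"
  shows "grad bernoulli x = (\<chi> i. u x \<bullet> (\<chi> j. pderiv_at i (\<lambda>y. u y $ j) x)) + neg_force x"
proof -
  have "pderiv_at i bernoulli x = (\<Sum>j\<in>UNIV. u x $ j * pderiv_at i (\<lambda>y. u y $ j) x)
      + sound_speed_sq p (\<rho> x) / \<rho> x * pderiv_at i \<rho> x - pderiv_at i \<phi> x" for i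
  proof (rule dir_deriv_eqI)
    note d = differentiable_data[OF assms, THEN has_real_derivative_dir_deriv]
    have "((\<lambda>t. h (\<rho> (x + t *\<^sub>R axis i 1))) has_real_derivative
        sound_speed_sq p (\<rho> x) / \<rho> x * pderiv_at i \<rho> x) (at 0)"
      by (rule DERIV_chain2[where f=h]) (use enthalpy[OF rho_pos[OF assms]] d in auto)
    then show "((\<lambda>t. bernoulli (x + t *\<^sub>R axis i 1)) has_real_derivative
        (\<Sum>j\<in>UNIV. u x $ j * pderiv_at i (\<lambda>y. u y $ j) x)
          + sound_speed_sq p (\<rho> x) / \<rho> x * pderiv_at i \<rho> x - pderiv_at i \<phi> x) (at 0)"
      unfolding bernoulli_fun_def
      by (auto intro!: derivative_eq_intros d simp: sum_3)
  qed
  then show ?thesis by (simp add: vec_eq_iff inner_vec_def)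
qed

lemma mass_balance:
  assumes "x \<in> U"
  shows "grad \<rho> x \<bullet> u x + \<rho> x * divergence u x = 0"
proof -
  have "(\<Sum>j\<in>UNIV. pderiv_at j (\<lambda>y. \<rho> y * u y $ j) x) = 0"
    using solution assms by (simp add: steady_euler_poisson_def)
  then show ?thesis
    using divergence_scaleR[of \<rho> x u] differentiable_data[OF assms]
    by (simp add: divergence_def)
qed

text \<open>In the divergence of rho u_i u the part u_i div(rho u) vanishes by mass conservation,
  and the remaining equation can be divided by rho > 0.\<close>

lemma momentum_balance:
  assumes "x \<in> U"
  shows "u x \<bullet> grad (\<lambda>y. u y $ i) x + neg_force x $ i = 0"
proof -
  note d = differentiable_data[OF assms]
  have mom: "(\<Sum>j\<in>UNIV. pderiv_at j (\<lambda>y. \<rho> y * u y $ i * u y $ j) x)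
            + pderiv_at i (\<lambda>y. p (\<rho> y)) x = \<rho> x * pderiv_at i \<phi> x"
    using solution assms by (simp add: steady_euler_poisson_def)
  have "(\<Sum>j\<in>UNIV. pderiv_at j (\<lambda>y. \<rho> y * u y $ i * u y $ j) x)
      = divergence (\<lambda>y. (\<rho> y * u y $ i) *\<^sub>R u y) x"
    by (simp add: divergence_def)
  also have "\<dots> = grad (\<lambda>y. \<rho> y * u y $ i) x \<bullet> u x + \<rho> x * u x $ i * divergence u x"
    by (rule divergence_scaleR) (auto intro!: differentiable_mult d)
  also have "\<dots> = \<rho> x * (u x \<bullet> grad (\<lambda>y. u y $ i) x)"
  proof -
    have "grad (\<lambda>y. \<rho> y * u y $ i) x \<bullet> u x
        = u x $ i * (grad \<rho> x \<bullet> u x) + \<rho> x * (u x \<bullet> grad (\<lambda>y. u y $ i) x)"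
      by (simp add: grad_mult d inner_simps inner_commute)
    then show ?thesis using mass_balance[OF assms] by algebra
  qed
  finally have inertia: "(\<Sum>j\<in>UNIV. pderiv_at j (\<lambda>y. \<rho> y * u y $ i * u y $ j) x)
      = \<rho> x * (u x \<bullet> grad (\<lambda>y. u y $ i) x)" .
  have "p differentiable (at (\<rho> x))"
    using smooth_on_imp_differentiable[OF p_smooth] rho_pos[OF assms] by simp
  then have "(p has_real_derivative sound_speed_sq p (\<rho> x)) (at (\<rho> x))"
    unfolding sound_speed_sq_def by (metis DERIV_imp_deriv real_differentiable_def)
  then have "pderiv_at i (\<lambda>y. p (\<rho> y)) x = sound_speed_sq p (\<rho> x) * pderiv_at i \<rho> x"
    by (rule dir_deriv_chain[OF d(1)])
  then show ?thesis
    using mom rho_pos[OF assms] unfolding inertia by (simp add: field_simps)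
qed

text \<open>The identity (u . grad) u = grad(|u|^2/2) - u x curl u, in components: the force terms
  in grad B and in the momentum balance cancel.\<close>

lemma lamb_form:
  assumes "x \<in> U"
  shows "grad bernoulli x = cross3 (u x) (curl u x)"
  using momentum_balance[OF assms, of 1] momentum_balance[OF assms, of 2]
    momentum_balance[OF assms, of 3]
  unfolding grad_bernoulli_fun[OF assms] vec_eq_iff forall_3 cross3_nth curl_nth
  by (simp add: inner_3 algebra_simps)

lemma grad_speed_squared:
  assumes "x \<in> U"
  shows "grad (\<lambda>y. u y \<bullet> u y) x = 2 *\<^sub>R (grad bernoulli x - neg_force x)"
proof -
  note d = differentiable_data[OF assms]
  have "pderiv_at i (\<lambda>y. u y \<bullet> u y) x = 2 * (\<Sum>j\<in>UNIV. u x $ j * pderiv_at i (\<lambda>y. u y $ j) x)" for i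
    unfolding inner_3 sum_3
    by (simp add: dir_deriv_add dir_deriv_mult d)
  then show ?thesis
    by (simp add: grad_bernoulli_fun[OF assms] vec_eq_iff inner_vec_def)
qed

lemma differentiable_sound_speed_sq:
  assumes "x \<in> U"
  shows "(\<lambda>y. sound_speed_sq p (\<rho> y)) differentiable (at x)"
  unfolding sound_speed_sq_def
  by (rule differentiable_real_chain[OF differentiable_data(1)[OF assms]],
      rule differentiable_deriv_of_smooth_on[OF p_smooth])
     (use rho_pos[OF assms] in simp)

lemma differentiable_bernoulli_fun:
  assumes "x \<in> U"
  shows "bernoulli differentiable (at x)"
proof -
  note d = differentiable_data[OF assms]
  have "h differentiable (at (\<rho> x))"
    using enthalpy[OF rho_pos[OF assms]] by (auto simp: real_differentiable_def)
  then have "(\<lambda>y. h (\<rho> y)) differentiable (at x)"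
    by (rule differentiable_real_chain[OF d(1)])
  then show ?thesis
    unfolding bernoulli_fun_def[abs_def]
    by (intro differentiable_diff differentiable_add differentiable_divide differentiable_power d) auto
qed

text \<open>No second derivative of \<open>h\<close> is assumed. The formula for grad B contains
  \<open>h\<close> only through c^2/rho, whose differentiability comes from the smoothness of
  \<open>p\<close> and rho.\<close>

lemma differentiable_grad_bernoulli_fun:
  assumes "x \<in> U"
  shows "pderiv_at i bernoulli differentiable (at x)"
proof (rule differentiable_cong_open[OF U_open assms])
  note d = differentiable_data[OF assms]
  show "pderiv_at i bernoulli y = u y \<bullet> (\<chi> j. pderiv_at i (\<lambda>y. u y $ j) y) + neg_force y $ i" if "y \<in> U" for y
    using arg_cong[OF grad_bernoulli_fun[OF that], of "\<lambda>v. v $ i"] by simp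
  have "\<rho> x \<noteq> 0" using rho_pos[OF assms] by simp
  then show "(\<lambda>y. u y \<bullet> (\<chi> j. pderiv_at i (\<lambda>y. u y $ j) y) + neg_force y $ i) differentiable (at x)"
    by (auto intro!: differentiable_inner_3 differentiable_diff differentiable_add differentiable_mult
        differentiable_divide differentiable_sound_speed_sq assms d)
qed

section \<open>Transport of the helicity density\<close>

text \<open>Both sides are the divergence of S omega, where S = |u|^2 and omega = curl u: the right
  side by div omega = 0, the left after splitting S omega along u and grad B x u.\<close>

lemma grad_helicity_along_flow:
  assumes "x \<in> U"
  shows "u x \<bullet> grad (\<lambda>y. u y \<bullet> curl u y) x + (u x \<bullet> curl u x) * divergence u x
      = grad (\<lambda>y. u y \<bullet> u y) x \<bullet> curl u x"
proof -
  note d = differentiable_data[OF assms] differentiable_curl_u[OF assms]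
  have dN: "(\<lambda>y. u y \<bullet> curl u y) differentiable (at x)"
    by (rule differentiable_inner_3) (rule d)+
  have dS: "(\<lambda>y. u y \<bullet> u y) differentiable (at x)"
    by (rule differentiable_inner_3) (rule d)+
  have dA: "(\<lambda>y. grad bernoulli y $ i) differentiable (at x)" for i
    by (simp add: differentiable_grad_bernoulli_fun[OF assms])
  \<comment> \<open>The triple product (u x omega) x u = S omega - N u, with N = u . omega and u x
    omega replaced by grad B.\<close>
  have decomp: "(u y \<bullet> u y) *\<^sub>R curl u y
      = (u y \<bullet> curl u y) *\<^sub>R u y + cross3 (grad bernoulli y) (u y)" if "y \<in> U" for y
    unfolding lamb_form[OF that]
    \<comment> \<open>Keeping the components of the curl opaque leaves a polynomial identity in six
      unknowns.\<close>
    by (simp add: vec_eq_iff forall_3 inner_3 del: curl_nth) (simp add: algebra_simps)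
  have "grad (\<lambda>y. u y \<bullet> u y) x \<bullet> curl u x
      = divergence (\<lambda>y. (u y \<bullet> u y) *\<^sub>R curl u y) x"
    using divergence_curl[OF U_open assms, of u] differentiable_data
    by (simp add: divergence_scaleR dS d assms)
  also have "\<dots> = divergence (\<lambda>y. (u y \<bullet> curl u y) *\<^sub>R u y + cross3 (grad bernoulli y) (u y)) x"
    by (rule divergence_cong[OF U_open assms decomp])
  also have "\<dots> = divergence (\<lambda>y. (u y \<bullet> curl u y) *\<^sub>R u y) x
      + divergence (\<lambda>y. cross3 (grad bernoulli y) (u y)) x"
  proof (rule divergence_add)
    show "(\<lambda>y. ((u y \<bullet> curl u y) *\<^sub>R u y) $ i) differentiable (at x)" for i
      by (simp add: differentiable_mult dN d)
    show "(\<lambda>y. cross3 (grad bernoulli y) (u y) $ i) differentiable (at x)" for i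
      using exhaust_3[of i] dA d by (auto intro!: differentiable_diff differentiable_mult)
  qed
  \<comment> \<open>This divergence is curl(grad B) . u - grad B . omega; the second term vanishes
    because grad B = u x omega is orthogonal to omega.\<close>
  also have "divergence (\<lambda>y. cross3 (grad bernoulli y) (u y)) x = 0"
    using divergence_cross3[OF dA, of u] d
      curl_grad[OF U_open assms differentiable_bernoulli_fun differentiable_grad_bernoulli_fun[OF assms]]
      lamb_form[OF assms]
    by (simp add: dot_cross_self)
  also have "divergence (\<lambda>y. (u y \<bullet> curl u y) *\<^sub>R u y) x
      = u x \<bullet> grad (\<lambda>y. u y \<bullet> curl u y) x + (u x \<bullet> curl u x) * divergence u x"
    by (simp add: divergence_scaleR dN d inner_commute)
  finally show ?thesis by simp
qed

section \<open>The balance law for W/(rho G) and its conservation\<close>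

text \<open>Numerator and denominator carry the same factor 1/u_1^2, which cancels.\<close>

lemma potential_vorticity_eq:
  assumes "x \<in> U"
  shows "W_fun u x / (\<rho> x * G_fun u x) = (u x \<bullet> curl u x) / (\<rho> x * (u x \<bullet> u x))"
  using u1_nonzero[OF assms]
  by (simp add: W_fun_eq G_fun_eq differentiable_data assms)

lemma differentiable_potential_vorticity:
  assumes "x \<in> U"
  shows "(\<lambda>y. W_fun u y / (\<rho> y * G_fun u y)) differentiable (at x)"
proof (rule differentiable_cong_open[OF U_open assms potential_vorticity_eq])
  have "\<rho> x * (u x \<bullet> u x) \<noteq> 0"
    using rho_pos[OF assms] u1_nonzero[OF assms] by auto
  then show "(\<lambda>y. (u y \<bullet> curl u y) / (\<rho> y * (u y \<bullet> u y))) differentiable (at x)"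
    by (intro differentiable_divide differentiable_mult differentiable_inner_3
        differentiable_data differentiable_curl_u assms)
qed

lemma D_op_potential_vorticity:
  assumes "x \<in> U"
  shows "D_op u (\<lambda>y. W_fun u y / (\<rho> y * G_fun u y)) x
    + 1 / (2 * \<rho> x * (bernoulli x + \<phi> x - h (\<rho> x))\<^sup>2) * (path_field u x \<bullet> cross3 (neg_force x) (grad bernoulli x)) = 0"
proof -
  note d = differentiable_data[OF assms] differentiable_curl_u[OF assms]
  define S where "S = (\<lambda>y. u y \<bullet> u y)"
  define N where "N = (\<lambda>y. u y \<bullet> curl u y)"
  have dS: "S differentiable (at x)" and dN: "N differentiable (at x)"
    unfolding S_def N_def by ((rule differentiable_inner_3; rule d))+
  have \<rho>: "\<rho> x \<noteq> 0" using rho_pos[OF assms] by simp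
  have u1: "u x $ 1 \<noteq> 0" using u1_nonzero[OF assms] .
  then have S: "S x \<noteq> 0" by (auto simp: S_def)
  have "bernoulli x + \<phi> x - h (\<rho> x) = S x / 2"
    by (simp add: bernoulli_fun_def S_def inner_3 power2_eq_square)
  \<comment> \<open>B + phi - h(rho) is the kinetic energy S/2, so the coefficient of the claim is
    an explicit function of rho and S.\<close>
  then have bern: "1 / (2 * \<rho> x * (bernoulli x + \<phi> x - h (\<rho> x))\<^sup>2) = 2 / (\<rho> x * (S x)\<^sup>2)"
    by (simp only: power_divide) simp
  have lamb: "S x *\<^sub>R curl u x - N x *\<^sub>R u x = cross3 (grad bernoulli x) (u x)"
    unfolding lamb_form[OF assms] S_def N_def
    by (simp add: vec_eq_iff forall_3 inner_3 del: curl_nth) (simp add: algebra_simps)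
  have hel: "u x \<bullet> grad N x = grad S x \<bullet> curl u x - N x * divergence u x"
    using grad_helicity_along_flow[OF assms] by (simp add: N_def S_def)
  have mass: "u x \<bullet> grad \<rho> x = - \<rho> x * divergence u x"
    using mass_balance[OF assms] by (simp add: inner_commute)
  have "grad (\<lambda>y. W_fun u y / (\<rho> y * G_fun u y)) x = grad (\<lambda>y. N y / (\<rho> y * S y)) x"
    unfolding N_def S_def by (rule grad_cong[OF U_open assms potential_vorticity_eq])
  also have "\<dots> = ((\<rho> x * S x) *\<^sub>R grad N x - N x *\<^sub>R (S x *\<^sub>R grad \<rho> x + \<rho> x *\<^sub>R grad S x))
      /\<^sub>R (\<rho> x * S x)\<^sup>2"
    using \<rho> S by (simp add: grad_divide grad_mult differentiable_mult d dS dN)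
  finally have "u x \<bullet> grad (\<lambda>y. W_fun u y / (\<rho> y * G_fun u y)) x
      = (\<rho> x * S x * (u x \<bullet> grad N x) - N x * (S x * (u x \<bullet> grad \<rho> x) + \<rho> x * (u x \<bullet> grad S x)))
        / (\<rho> x * S x)\<^sup>2"
    by (simp add: inner_simps divide_inverse mult.commute)
  \<comment> \<open>The term in div u from the helicity equation cancels the one from mass
    conservation.\<close>
  also have "\<dots> = \<rho> x * (grad S x \<bullet> (S x *\<^sub>R curl u x - N x *\<^sub>R u x)) / (\<rho> x * S x)\<^sup>2"
    unfolding hel mass by (simp add: inner_simps inner_commute algebra_simps)
  also have "grad S x \<bullet> (S x *\<^sub>R curl u x - N x *\<^sub>R u x) = - 2 * (u x \<bullet> cross3 (neg_force x) (grad bernoulli x))"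
  proof -
    \<comment> \<open>Here \<open>a\<close> is grad B, \<open>f\<close> the negative force and
      \<open>v\<close> the velocity. The \<open>a\<close> part drops out by orthogonality to a x v,
      and the rest is a cyclic permutation of the scalar triple product.\<close>
    have "2 *\<^sub>R (a - f) \<bullet> cross3 a v = - 2 * (v \<bullet> cross3 f a)" for a f v :: "real^3"
      by (simp add: inner_3 algebra_simps)
    moreover have "grad S x = 2 *\<^sub>R (grad bernoulli x - neg_force x)"
      unfolding S_def by (rule grad_speed_squared[OF assms])
    ultimately show ?thesis by (simp only: lamb)
  qed
  finally have "u x \<bullet> grad (\<lambda>y. W_fun u y / (\<rho> y * G_fun u y)) x
      = - 2 * (u x \<bullet> cross3 (neg_force x) (grad bernoulli x)) / (\<rho> x * (S x)\<^sup>2)"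
    using \<rho> by (simp add: power2_eq_square)
  \<comment> \<open>Since the path field is u/u_1, dividing the identity for u . grad by u_1 gives
    the one for D.\<close>
  then show ?thesis
    unfolding D_op_eq bern path_field_eq[of u x, OF u1] inner_scaleR_left
    using \<rho> S u1 by (simp add: field_simps)
qed

text \<open>By the chain rule the derivative along the path is D applied to the quantity, hence
  zero. An interval is convex, so a vanishing derivative within it, one-sided at endpoints, forces
  constancy.\<close>

lemma potential_vorticity_conserved:
  assumes "particle_path u U I \<gamma>"
    and D: "\<And>x. x \<in> U \<Longrightarrow> D_op u (\<lambda>y. W_fun u y / (\<rho> y * G_fun u y)) x = 0"
  shows "(\<lambda>t. W_fun u (\<gamma> t) / (\<rho> (\<gamma> t) * G_fun u (\<gamma> t))) constant_on I"
proof -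
  define Q where "Q = (\<lambda>y. W_fun u y / (\<rho> y * G_fun u y))"
  have "((\<lambda>t. Q (\<gamma> t)) has_derivative (\<lambda>_. 0)) (at t within I)" if "t \<in> I" for t
  proof -
    have g: "\<gamma> t \<in> U" "(\<gamma> has_derivative (\<lambda>s. s *\<^sub>R path_field u (\<gamma> t))) (at t within I)"
      using assms(1) that by (auto simp: particle_path_def has_vector_derivative_def)
    obtain Q' where Q': "(Q has_derivative Q') (at (\<gamma> t))"
      using differentiable_potential_vorticity[OF g(1)] by (auto simp: differentiable_def Q_def)
    have "((\<lambda>t. Q (\<gamma> t)) has_derivative (\<lambda>s. Q' (s *\<^sub>R path_field u (\<gamma> t)))) (at t within I)"
      by (rule has_derivative_compose[OF g(2) Q'])
    moreover have "Q' (s *\<^sub>R path_field u (\<gamma> t)) = 0" for s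
      using D[OF g(1)] by (simp add: frechet_eq_inner_grad[OF Q'] D_op_eq Q_def)
    ultimately show ?thesis by simp
  qed
  moreover have "convex I"
    using assms(1) by (simp add: particle_path_def is_interval_convex)
  ultimately have "\<exists>c. \<forall>t\<in>I. Q (\<gamma> t) = c"
    by (intro has_derivative_zero_constant)
  then show ?thesis by (simp add: constant_on_def Q_def)
qed

end

section \<open>The balance law and the case of constant B\<close>

theorem mainTheorem2:
  fixes U :: "(real^3) set"
    and p h :: "real \<Rightarrow> real"
    and b \<rho> \<phi> :: "real^3 \<Rightarrow> real"
    and u :: "real^3 \<Rightarrow> real^3"
  defines "B \<equiv> bernoulli_fun h \<rho> u \<phi>"
    and "Q \<equiv> (\<lambda>x. W_fun u x / (\<rho> x * G_fun u x))"
  assumes p_smooth: "smooth_on {0<..} p"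
    and p_deriv_pos: "\<And>r. r > 0 \<Longrightarrow> deriv p r > 0"
    and enthalpy: "\<And>r. r > 0 \<Longrightarrow> (h has_real_derivative sound_speed_sq p r / r) (at r)"
    and U_open: "open U"
    and rho_smooth: "smooth_on U \<rho>"
    and u_smooth: "\<And>i. smooth_on U (\<lambda>x. u x $ i)"
    and phi_smooth: "smooth_on U \<phi>"
    and rho_pos: "\<And>x. x \<in> U \<Longrightarrow> \<rho> x > 0"
    and u1_nonzero: "\<And>x. x \<in> U \<Longrightarrow> u x $ 1 \<noteq> 0"
    and solution: "steady_euler_poisson p b U \<rho> u \<phi>"
  shows "(\<forall>x\<in>U. D_op u Q x
            + 1 / (2 * \<rho> x * (B x + \<phi> x - h (\<rho> x))\<^sup>2)
              * (path_field u x \<bullet>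
                 cross3 ((sound_speed_sq p (\<rho> x) / \<rho> x) *\<^sub>R grad \<rho> x - grad \<phi> x) (grad B x)) = 0)
       \<and> (B constant_on U \<longrightarrow>
            (\<forall>x\<in>U. D_op u Q x = 0)
            \<and> (\<forall>I \<gamma>. particle_path u U I \<gamma> \<longrightarrow> (\<lambda>t. Q (\<gamma> t)) constant_on I))"
proof -
  note euler = p_smooth enthalpy U_open rho_smooth u_smooth phi_smooth rho_pos u1_nonzero solution
  have balance: "D_op u Q x + 1 / (2 * \<rho> x * (B x + \<phi> x - h (\<rho> x))\<^sup>2)
      * (path_field u x \<bullet>
         cross3 ((sound_speed_sq p (\<rho> x) / \<rho> x) *\<^sub>R grad \<rho> x - grad \<phi> x) (grad B x)) = 0"
    if "x \<in> U" for x
    unfolding B_def Q_def by (rule D_op_potential_vorticity[OF euler that])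
  have D0: "D_op u Q x = 0" if const: "B constant_on U" and x: "x \<in> U" for x
  proof -
    obtain c where "\<And>y. y \<in> U \<Longrightarrow> B y = c"
      using const by (auto simp: constant_on_def)
    \<comment> \<open>\<open>B\<close> is constant only on \<open>U\<close>, so openness is used to
      compare it with a globally constant function; the cross product with grad B then
      vanishes.\<close>
    then have "grad B x = grad (\<lambda>_. c) x"
      by (rule grad_cong[OF U_open x])
    also have "\<dots> = 0" by (simp add: vec_eq_iff dir_deriv_def)
    finally show ?thesis using balance[OF x] by simp
  qed
  have "(\<lambda>t. Q (\<gamma> t)) constant_on I" if "B constant_on U" "particle_path u U I \<gamma>" for I \<gamma>
    using potential_vorticity_conserved[OF euler that(2)] D0[OF that(1)] unfolding Q_def by blast
  with balance D0 show ?thesis by blast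
qed

end
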